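(* Canonically associated with any homomorphism of principal bundles $(\Phi,\psi):(P,M,G)\to(P',M',G')$ is a homomorphism of semiheap bundles $(P,M,S_G)\to(P',M',S_{G'})$; namely, the same pair $(\Phi,\psi)$ is a homomorphism of the associated semiheap bundles.
   Context: All manifolds are real, finite dimensional, Hausdorff, second countable smooth manifolds. A homomorphism of principal bundles $(\Phi,\psi):(P,M,G)\to(P',M',G')$ is a Lie group homomorphism $\psi:G\to G'$ and a smooth bundle map $\Phi:P\to P'$ (over some smooth $\phi:M\to M'$) with $\Phi(a_g(p))=a'_{\psi(g)}(\Phi(p))$, where $a,a'$ denote the principal right actions. A Lie semiheap is a smooth manifold $S$ with a smooth map $\mu:S^3\to S$, $\mu(x,y,z)=[x,y,z]$, satisfying $[[x_1,x_2,x_3],x_4,x_5]=[x_1,[x_4,x_3,x_2],x_5]=[x_1,x_2,[x_3,x_4,x_5]]$. A Lie semiheap homomorphism is a smooth map preserving the ternary operations. For a Lie group $G$, $S_G$ denotes $G$ with $[g_1,g_2,g_3]:=g_1g_2^{-1}g_3$. A right action of a Lie semiheap $S$ on a manifold $N$ is a smooth map $N\times S\times S\to N$, $(n,x,y)\mapsto n\triangleleft(x,y)$, with $(n\triangleleft(x_1,x_2))\triangleleft(x_3,x_4)=n\triangleleft(x_1,[x_2,x_3,x_4])$; $N$ is then an $S$-space. A semiheap bundle $(P,M,S)$ consists of: (1) an $S$-space $P$; (2) a surjective submersion $\pi:P\to M$ with $\pi(p\triangleleft(x,y))=\pi(p)$; (3) an open cover $\{U_i\}$ of $M$ and diffeomorphisms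 $t_i:\pi^{-1}(U_i)\to U_i\times S$ with $\mathrm{prj}_1\circ t_i=\pi$ that are $S$-equivariant, where $S$ acts on $U_i\times S$ by $(m,x)\triangleleft(x_1,x_2)=(m,[x,x_1,x_2])$. The semiheap bundle $(P,M,S_G)$ associated with a principal bundle $(P,M,G)$ has the same projection and the action $p\triangleleft(g_1,g_2):=a_{g_1^{-1}g_2}(p)$. A semiheap bundle homomorphism $(P,M,S)\to(P',M',S')$ is a pair $(\Phi,\psi)$ with $\psi:S\to S'$ a Lie semiheap homomorphism and $\Phi:P\to P'$ a smooth bundle map (over some smooth $\phi:M\to M'$) such that $\Phi(p\triangleleft(x,y))=\Phi(p)\triangleleft(\psi(x),\psi(y))$ for all $p\in P$, $x,y\in S$. *)

theory Defs
  imports "HOL-Analysis.Analysis" "HOL-Algebra.Group"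
begin

section \<open>Model spaces and smooth maps between them\<close>

text \<open>
  Charts take values in a type of class \<open>real_inner\<close>; finite-dimensionality is part of
  the definition of a manifold. The class \<open>euclidean_space\<close> is not used because it
  excludes dimension 0, hence discrete manifolds and discrete structure groups. The
  following instance provides a model space of dimension 0.
\<close>

instantiation unit :: real_inner
begin

definition "zero_unit = ()"
definition "plus_unit (x::unit) (y::unit) = ()"
definition "scaleR_unit (r::real) (x::unit) = ()"
definition "inner_unit (x::unit) (y::unit) = (0::real)"
definition "norm_unit (x::unit) = (0::real)"
definition "dist_unit (x::unit) (y::unit) = (0::real)"
definition "sgn_unit (x::unit) = ()"
definition uniformity_unit :: "(unit \<times> unit) filter"
  where "uniformity_unit = (INF e\<in>{0 <..}. principal {(x, y). dist x y < e})"
definition open_unit :: "unit set \<Rightarrow> bool"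
  where "open_unit U \<longleftrightarrow> (\<forall>x\<in>U. eventually (\<lambda>(x', y). x' = x \<longrightarrow> y \<in> U) uniformity)"

instance
  by standard (auto simp: inner_unit_def norm_unit_def dist_unit_def uniformity_unit_def open_unit_def)

end

text \<open>
  On an open subset of a finite-dimensional space, being \<open>C\<^sup>k\<^sup>+\<^sup>1\<close> amounts to being
  differentiable with all directional derivatives \<open>x \<mapsto> D f x v\<close> of class \<open>C\<^sup>k\<close>.
\<close>

primrec Ck_on :: "nat \<Rightarrow> 'a::real_normed_vector set \<Rightarrow> ('a \<Rightarrow> 'b::real_normed_vector) \<Rightarrow> bool" where
  "Ck_on 0 S f \<longleftrightarrow> continuous_on S f"
| "Ck_on (Suc k) S f \<longleftrightarrow>
     (\<exists>D. (\<forall>x\<in>S. (f has_derivative D x) (at x)) \<and> (\<forall>v. Ck_on k S (\<lambda>x. D x v)))"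

definition smooth_on :: "'a::real_inner set \<Rightarrow> ('a \<Rightarrow> 'b::real_inner) \<Rightarrow> bool" where
  "smooth_on S f \<longleftrightarrow> (\<forall>k. Ck_on k S f)"


section \<open>Smooth manifolds\<close>

text \<open>
  A manifold is a topological space with an atlas, which need not be maximal. A chart is
  a pair of its domain and its coordinate map; the values of coordinate maps, and of all
  maps below, outside their domains are irrelevant.
\<close>

record ('a, 'e) manifold =
  mtop :: "'a topology"
  atlas :: "('a set \<times> ('a \<Rightarrow> 'e)) set"

abbreviation points :: "('a, 'e, 'z) manifold_scheme \<Rightarrow> 'a set" where
  "points M \<equiv> topspace (mtop M)"

definition smooth_manifold :: "('a, 'e::real_inner) manifold \<Rightarrow> bool" where
  "smooth_manifold M \<longleftrightarrow>
     (\<exists>B :: 'e set. finite B \<and> span B = UNIV) \<and>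
     Hausdorff_space (mtop M) \<and>
     second_countable (mtop M) \<and>
     (\<forall>(U, \<phi>)\<in>atlas M. openin (mtop M) U \<and> open (\<phi> ` U) \<and>
        homeomorphic_map (subtopology (mtop M) U) (top_of_set (\<phi> ` U)) \<phi>) \<and>
     (\<Union>(U, \<phi>)\<in>atlas M. U) = points M \<and>
     (\<forall>(U, \<phi>)\<in>atlas M. \<forall>(V, \<psi>)\<in>atlas M.
        smooth_on (\<phi> ` (U \<inter> V)) (\<psi> \<circ> inv_into U \<phi>))"

definition smooth_map ::
  "('a, 'e::real_inner) manifold \<Rightarrow> ('b, 'f::real_inner) manifold \<Rightarrow> ('a \<Rightarrow> 'b) \<Rightarrow> bool" where
  "smooth_map M N f \<longleftrightarrow>
     continuous_map (mtop M) (mtop N) f \<and>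
     (\<forall>(U, \<phi>)\<in>atlas M. \<forall>(V, \<psi>)\<in>atlas N.
        smooth_on (\<phi> ` (U \<inter> f -` V)) (\<psi> \<circ> f \<circ> inv_into U \<phi>))"

definition diffeomorphism ::
  "('a, 'e::real_inner) manifold \<Rightarrow> ('b, 'f::real_inner) manifold \<Rightarrow> ('a \<Rightarrow> 'b) \<Rightarrow> bool" where
  "diffeomorphism M N f \<longleftrightarrow>
     bij_betw f (points M) (points N) \<and> smooth_map M N f \<and> smooth_map N M (inv_into (points M) f)"

definition submersion ::
  "('a, 'e::real_inner) manifold \<Rightarrow> ('b, 'f::real_inner) manifold \<Rightarrow> ('a \<Rightarrow> 'b) \<Rightarrow> bool" where
  "submersion M N f \<longleftrightarrow>
     smooth_map M N f \<and>
     (\<forall>(U, \<phi>)\<in>atlas M. \<forall>(V, \<psi>)\<in>atlas N. \<forall>p\<in>U \<inter> f -` V.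
        \<exists>D. ((\<psi> \<circ> f \<circ> inv_into U \<phi>) has_derivative D) (at (\<phi> p)) \<and> surj D)"

definition prod_manifold ::
  "('a, 'e) manifold \<Rightarrow> ('b, 'f) manifold \<Rightarrow> ('a \<times> 'b, 'e \<times> 'f) manifold" (infixr \<open>\<times>\<^sub>M\<close> 80) where
  "M \<times>\<^sub>M N =
     \<lparr>mtop = prod_topology (mtop M) (mtop N),
      atlas = {(U \<times> V, map_prod \<phi> \<psi>) | U \<phi> V \<psi>. (U, \<phi>) \<in> atlas M \<and> (V, \<psi>) \<in> atlas N}\<rparr>"

definition open_submanifold :: "('a, 'e) manifold \<Rightarrow> 'a set \<Rightarrow> ('a, 'e) manifold" where
  "open_submanifold M W =
     \<lparr>mtop = subtopology (mtop M) W, atlas = {(U \<inter> W, \<phi>) | U \<phi>. (U, \<phi>) \<in> atlas M}\<rparr>"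


section \<open>Lie groups and Lie semiheaps\<close>

record ('g, 'e) lie_group_data = "'g monoid" +
  gmfd :: "('g, 'e) manifold"

definition lie_group :: "('g, 'e::real_inner) lie_group_data \<Rightarrow> bool" where
  "lie_group G \<longleftrightarrow>
     group G \<and> smooth_manifold (gmfd G) \<and> points (gmfd G) = carrier G \<and>
     smooth_map (gmfd G \<times>\<^sub>M gmfd G) (gmfd G) (\<lambda>(x, y). x \<otimes>\<^bsub>G\<^esub> y) \<and>
     smooth_map (gmfd G) (gmfd G) (\<lambda>x. inv\<^bsub>G\<^esub> x)"

definition lie_group_hom ::
  "('g, 'e::real_inner) lie_group_data \<Rightarrow> ('h, 'f::real_inner) lie_group_data \<Rightarrow>
   ('g \<Rightarrow> 'h) \<Rightarrow> bool" where
  "lie_group_hom G H \<psi> \<longleftrightarrow>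
     lie_group G \<and> lie_group H \<and> smooth_map (gmfd G) (gmfd H) \<psi> \<and> \<psi> \<in> hom G H"

record ('s, 'e) semiheap_data =
  smfd :: "('s, 'e) manifold"
  tern :: "'s \<Rightarrow> 's \<Rightarrow> 's \<Rightarrow> 's"

definition lie_semiheap :: "('s, 'e::real_inner) semiheap_data \<Rightarrow> bool" where
  "lie_semiheap S \<longleftrightarrow>
     smooth_manifold (smfd S) \<and>
     smooth_map (smfd S \<times>\<^sub>M smfd S \<times>\<^sub>M smfd S) (smfd S) (\<lambda>(x, y, z). tern S x y z) \<and>
     (\<forall>x1\<in>points (smfd S). \<forall>x2\<in>points (smfd S). \<forall>x3\<in>points (smfd S).
      \<forall>x4\<in>points (smfd S). \<forall>x5\<in>points (smfd S).
        tern S (tern S x1 x2 x3) x4 x5 = tern S x1 (tern S x4 x3 x2) x5 \<and>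
        tern S x1 (tern S x4 x3 x2) x5 = tern S x1 x2 (tern S x3 x4 x5))"

definition lie_semiheap_hom ::
  "('s, 'e::real_inner) semiheap_data \<Rightarrow> ('t, 'f::real_inner) semiheap_data \<Rightarrow>
   ('s \<Rightarrow> 't) \<Rightarrow> bool" where
  "lie_semiheap_hom S T \<psi> \<longleftrightarrow>
     lie_semiheap S \<and> lie_semiheap T \<and> smooth_map (smfd S) (smfd T) \<psi> \<and>
     (\<forall>x\<in>points (smfd S). \<forall>y\<in>points (smfd S). \<forall>z\<in>points (smfd S).
        \<psi> (tern S x y z) = tern T (\<psi> x) (\<psi> y) (\<psi> z))"

definition group_semiheap :: "('g, 'e) lie_group_data \<Rightarrow> ('g, 'e) semiheap_data" where
  "group_semiheap G =
     \<lparr>smfd = gmfd G, tern = (\<lambda>x y z. x \<otimes>\<^bsub>G\<^esub> inv\<^bsub>G\<^esub> y \<otimes>\<^bsub>G\<^esub> z)\<rparr>"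


section \<open>Principal bundles and semiheap bundles\<close>

record ('p, 'm, 'ep, 'em) fibred_manifold =
  total :: "('p, 'ep) manifold"
  base :: "('m, 'em) manifold"
  proj :: "'p \<Rightarrow> 'm"

record ('p, 'm, 'g, 'ep, 'em, 'eg) principal_bundle_data =
  "('p, 'm, 'ep, 'em) fibred_manifold" +
  struct_group :: "('g, 'eg) lie_group_data"
  gact :: "'p \<Rightarrow> 'g \<Rightarrow> 'p"

record ('p, 'm, 's, 'ep, 'em, 'es) semiheap_bundle_data =
  "('p, 'm, 'ep, 'em) fibred_manifold" +
  struct_semiheap :: "('s, 'es) semiheap_data"
  hact :: "'p \<Rightarrow> 's \<Rightarrow> 's \<Rightarrow> 'p"

definition fibred_manifold ::
  "('p, 'm, 'ep::real_inner, 'em::real_inner, 'z) fibred_manifold_scheme \<Rightarrow> bool" where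
  "fibred_manifold B \<longleftrightarrow>
     smooth_manifold (total B) \<and> smooth_manifold (base B) \<and>
     submersion (total B) (base B) (proj B) \<and> proj B ` points (total B) = points (base B)"

definition part_over ::
  "('p, 'm, 'ep, 'em, 'z) fibred_manifold_scheme \<Rightarrow> 'm set \<Rightarrow> 'p set" where
  "part_over B U = {p \<in> points (total B). proj B p \<in> U}"

definition local_trivialization ::
  "('p, 'm, 'ep::real_inner, 'em::real_inner, 'z) fibred_manifold_scheme \<Rightarrow>
   ('f, 'ef::real_inner) manifold \<Rightarrow> 'm set \<Rightarrow> ('p \<Rightarrow> 'm \<times> 'f) \<Rightarrow> bool" where
  "local_trivialization B F U t \<longleftrightarrow>
     openin (mtop (base B)) U \<and>
     diffeomorphism (open_submanifold (total B) (part_over B U)) (open_submanifold (base B) U \<times>\<^sub>M F) t \<and>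
     (\<forall>p\<in>part_over B U. fst (t p) = proj B p)"

definition smooth_bundle_map ::
  "('p, 'm, 'ep::real_inner, 'em::real_inner, 'z) fibred_manifold_scheme \<Rightarrow>
   ('q, 'n, 'eq::real_inner, 'en::real_inner, 'y) fibred_manifold_scheme \<Rightarrow>
   ('p \<Rightarrow> 'q) \<Rightarrow> bool" where
  "smooth_bundle_map B C \<Phi> \<longleftrightarrow>
     smooth_map (total B) (total C) \<Phi> \<and>
     (\<exists>\<phi>. smooth_map (base B) (base C) \<phi> \<and> (\<forall>p\<in>points (total B). proj C (\<Phi> p) = \<phi> (proj B p)))"

text \<open>
  That the action is free and transitive on the fibres is a consequence of the
  existence of equivariant local trivializations.
\<close>

definition principal_bundle ::
  "('p, 'm, 'g, 'ep::real_inner, 'em::real_inner, 'eg::real_inner) principal_bundle_data \<Rightarrow> bool"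
  where
  "principal_bundle B \<longleftrightarrow> (let G = struct_group B; P = total B in
     fibred_manifold B \<and> lie_group G \<and>
     smooth_map (P \<times>\<^sub>M gmfd G) P (\<lambda>(p, g). gact B p g) \<and>
     (\<forall>p\<in>points P. gact B p \<one>\<^bsub>G\<^esub> = p) \<and>
     (\<forall>p\<in>points P. \<forall>g\<in>carrier G. \<forall>h\<in>carrier G.
        gact B (gact B p g) h = gact B p (g \<otimes>\<^bsub>G\<^esub> h)) \<and>
     (\<forall>p\<in>points P. \<forall>g\<in>carrier G. proj B (gact B p g) = proj B p) \<and>
     (\<exists>\<T>. (\<Union>(U, t)\<in>\<T>. U) = points (base B) \<and>
        (\<forall>(U, t)\<in>\<T>. local_trivialization B (gmfd G) U t \<and>
           (\<forall>p\<in>part_over B U. \<forall>g\<in>carrier G.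
              t (gact B p g) = (fst (t p), snd (t p) \<otimes>\<^bsub>G\<^esub> g)))))"

definition principal_bundle_hom ::
  "('p, 'm, 'g, 'ep::real_inner, 'em::real_inner, 'eg::real_inner) principal_bundle_data \<Rightarrow>
   ('q, 'n, 'h, 'eq::real_inner, 'en::real_inner, 'eh::real_inner) principal_bundle_data \<Rightarrow>
   ('p \<Rightarrow> 'q) \<Rightarrow> ('g \<Rightarrow> 'h) \<Rightarrow> bool" where
  "principal_bundle_hom B C \<Phi> \<psi> \<longleftrightarrow>
     principal_bundle B \<and> principal_bundle C \<and>
     lie_group_hom (struct_group B) (struct_group C) \<psi> \<and>
     smooth_bundle_map B C \<Phi> \<and>
     (\<forall>p\<in>points (total B). \<forall>g\<in>carrier (struct_group B).
        \<Phi> (gact B p g) = gact C (\<Phi> p) (\<psi> g))"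

definition semiheap_bundle ::
  "('p, 'm, 's, 'ep::real_inner, 'em::real_inner, 'es::real_inner) semiheap_bundle_data \<Rightarrow> bool"
  where
  "semiheap_bundle B \<longleftrightarrow> (let S = struct_semiheap B; H = points (smfd S); P = total B in
     fibred_manifold B \<and> lie_semiheap S \<and>
     smooth_map (P \<times>\<^sub>M smfd S \<times>\<^sub>M smfd S) P (\<lambda>(p, x, y). hact B p x y) \<and>
     (\<forall>p\<in>points P. \<forall>x1\<in>H. \<forall>x2\<in>H. \<forall>x3\<in>H. \<forall>x4\<in>H.
        hact B (hact B p x1 x2) x3 x4 = hact B p x1 (tern S x2 x3 x4)) \<and>
     (\<forall>p\<in>points P. \<forall>x\<in>H. \<forall>y\<in>H. proj B (hact B p x y) = proj B p) \<and>
     (\<exists>\<T>. (\<Union>(U, t)\<in>\<T>. U) = points (base B) \<and>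
        (\<forall>(U, t)\<in>\<T>. local_trivialization B (smfd S) U t \<and>
           (\<forall>p\<in>part_over B U. \<forall>x\<in>H. \<forall>y\<in>H.
              t (hact B p x y) = (fst (t p), tern S (snd (t p)) x y)))))"

definition semiheap_bundle_hom ::
  "('p, 'm, 's, 'ep::real_inner, 'em::real_inner, 'es::real_inner) semiheap_bundle_data \<Rightarrow>
   ('q, 'n, 't, 'eq::real_inner, 'en::real_inner, 'et::real_inner) semiheap_bundle_data \<Rightarrow>
   ('p \<Rightarrow> 'q) \<Rightarrow> ('s \<Rightarrow> 't) \<Rightarrow> bool" where
  "semiheap_bundle_hom B C \<Phi> \<psi> \<longleftrightarrow>
     semiheap_bundle B \<and> semiheap_bundle C \<and>
     lie_semiheap_hom (struct_semiheap B) (struct_semiheap C) \<psi> \<and>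
     smooth_bundle_map B C \<Phi> \<and>
     (\<forall>p\<in>points (total B). \<forall>x\<in>points (smfd (struct_semiheap B)). \<forall>y\<in>points (smfd (struct_semiheap B)).
        \<Phi> (hact B p x y) = hact C (\<Phi> p) (\<psi> x) (\<psi> y))"

definition associated_semiheap_bundle ::
  "('p, 'm, 'g, 'ep, 'em, 'eg) principal_bundle_data \<Rightarrow>
   ('p, 'm, 'g, 'ep, 'em, 'eg) semiheap_bundle_data" where
  "associated_semiheap_bundle B =
     \<lparr>total = total B, base = base B, proj = proj B,
      struct_semiheap = group_semiheap (struct_group B),
      hact = (\<lambda>p x y. gact B p (inv\<^bsub>struct_group B\<^esub> x \<otimes>\<^bsub>struct_group B\<^esub> y))\<rparr>"

end

theory Submission
  imports Defs
begin

text \<open>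
  The algebra is short: \<open>p \<triangleleft> (x, y) = p \<cdot> (x\<inverse> y)\<close>, and a group homomorphism satisfies
  \<open>\<psi> (x\<inverse> y) = (\<psi> x)\<inverse> \<psi> y\<close>, so equivariance under the group gives equivariance under
  the semiheap; the trivializations of the principal bundle remain equivariant because
  \<open>g (x\<inverse> y) = [g, x, y]\<close>. The analytic content is that \<open>[x, y, z]\<close> and \<open>p \<triangleleft> (x, y)\<close> are smooth,
  being composites of the smooth structure maps with projections and pairings; this rests
  on the chain rule for \<open>C\<^sup>k\<close> maps and on products of manifolds being manifolds.
\<close>

section \<open>Calculus of \<open>C\<^sup>k\<close> maps\<close>

text \<open>The residual \<open>?w\<close> is orthogonal to every element of \<open>C\<close>, hence
  to its span, which is the whole space, hence to itself. A zero vector in \<open>C\<close> does no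
  harm, since its summand is a multiple of 0.\<close>

lemma orthogonal_spanning_set_expansion:
  fixes C :: "'a::real_inner set"
  assumes "finite C" and "pairwise orthogonal C" and span: "span C = UNIV"
  shows "(\<Sum>b\<in>C. ((v \<bullet> b) / (b \<bullet> b)) *\<^sub>R b) = v"
proof -
  let ?w = "v - (\<Sum>b\<in>C. ((v \<bullet> b) / (b \<bullet> b)) *\<^sub>R b)"
  have "orthogonal ?w c" if c: "c \<in> C" for c
  proof -
    have "(\<Sum>b\<in>C. ((v \<bullet> b) / (b \<bullet> b)) * (b \<bullet> c)) = (\<Sum>b\<in>{c}. ((v \<bullet> b) / (b \<bullet> b)) * (b \<bullet> c))"
      using assms(1,2) c
      by (intro sum.mono_neutral_right) (auto simp: pairwise_def orthogonal_def)
    then show ?thesis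
      by (simp add: orthogonal_def inner_diff_left inner_sum_left)
  qed
  then have "orthogonal ?w ?w"
    using orthogonal_to_span[of ?w C ?w] span by auto
  then show ?thesis by (simp add: orthogonal_self)
qed

section \<open>Restriction, congruence and localization of C^k maps\<close>

lemma Ck_on_subset: "Ck_on k S f \<Longrightarrow> T \<subseteq> S \<Longrightarrow> Ck_on k T f"
proof (induction k arbitrary: f)
  case 0
  then show ?case by (simp add: continuous_on_subset)
next
  case (Suc k)
  then show ?case by (auto 0 3)
qed

text \<open>Derivatives are taken \<open>at x\<close>, not within \<open>S\<close>, so they see a
  full neighbourhood of \<open>x\<close>; openness of \<open>S\<close> provides one on which the two
  functions agree.\<close>

lemma Ck_on_cong:
  assumes "open S" and "\<And>x. x \<in> S \<Longrightarrow> f x = g x" and "Ck_on k S f"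
  shows "Ck_on k S g"
proof (cases k)
  case 0
  with assms show ?thesis using continuous_on_cong by force
next
  case (Suc l)
  with assms obtain D where "\<forall>x\<in>S. (f has_derivative D x) (at x)" "\<forall>v. Ck_on l S (\<lambda>x. D x v)"
    by auto
  with assms(1,2) Suc show ?thesis
    by (auto intro!: exI[of _ D] intro: has_derivative_transform_within_open)
qed

text \<open>Derivatives are unique, so the existentially quantified \<open>D\<close> can be replaced
  on \<open>S\<close> by a canonical choice. This lets derivatives found on different open sets be
  compared.\<close>

lemma Ck_on_Suc_frechet:
  assumes "open S"
  shows "Ck_on (Suc k) S f \<longleftrightarrow>
    (\<forall>x\<in>S. f differentiable at x) \<and> (\<forall>v. Ck_on k S (\<lambda>x. frechet_derivative f (at x) v))"
proof
  assume "Ck_on (Suc k) S f"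
  then obtain D where D: "\<forall>x\<in>S. (f has_derivative D x) (at x)" "\<forall>v. Ck_on k S (\<lambda>x. D x v)"
    by auto
  have "D x = frechet_derivative f (at x)" if "x \<in> S" for x
    using D(1) that frechet_derivative_at by blast
  with D show "(\<forall>x\<in>S. f differentiable at x) \<and> (\<forall>v. Ck_on k S (\<lambda>x. frechet_derivative f (at x) v))"
    using Ck_on_cong[OF assms, of "\<lambda>x. D x v" "\<lambda>x. frechet_derivative f (at x) v" k for v]
    by (auto simp: differentiable_def)
next
  assume "(\<forall>x\<in>S. f differentiable at x) \<and> (\<forall>v. Ck_on k S (\<lambda>x. frechet_derivative f (at x) v))"
  then show "Ck_on (Suc k) S f"
    by (auto simp: frechet_derivative_works intro!: exI[of _ "\<lambda>x. frechet_derivative f (at x)"])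
qed

text \<open>The derivatives supplied by the various neighbourhoods are all the Frechet derivative of
  \<open>f\<close>, so they glue to a single \<open>D\<close> on \<open>S\<close>, and the induction
  applies to its directional derivatives.\<close>

lemma Ck_on_locally:
  assumes "\<And>x. x \<in> S \<Longrightarrow> \<exists>T. open T \<and> x \<in> T \<and> Ck_on k T f"
  shows "Ck_on k S f"
  using assms
proof (induction k arbitrary: f S)
  case 0
  then have "continuous (at x) f" if "x \<in> S" for x
    using that by (metis Ck_on.simps(1) continuous_on_eq_continuous_at)
  then show ?case by (simp add: continuous_at_imp_continuous_on)
next
  case (Suc k)
  have diff: "f differentiable at x" if "x \<in> S" for x
    using Suc.prems[OF that] by (auto simp: differentiable_def)
  have "Ck_on k S (\<lambda>x. frechet_derivative f (at x) v)" for v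
    using Suc.prems by (intro Suc.IH) (metis Ck_on_Suc_frechet)
  with diff show ?case
    by (auto simp: frechet_derivative_works intro!: exI[of _ "\<lambda>x. frechet_derivative f (at x)"])
qed

section \<open>Closure of C^k maps under algebraic operations and pairing\<close>

lemma Ck_on_SucI:
  assumes "\<And>x. x \<in> S \<Longrightarrow> (f has_derivative D x) (at x)" and "\<And>v. Ck_on k S (\<lambda>x. D x v)"
  shows "Ck_on (Suc k) S f"
  using assms by auto

lemma Ck_on_SucE:
  assumes "Ck_on (Suc k) S f"
  obtains D where "\<And>x. x \<in> S \<Longrightarrow> (f has_derivative D x) (at x)" "\<And>v. Ck_on k S (\<lambda>x. D x v)"
  using assms by auto

text \<open>Differentiability implies continuity, which starts the induction. The product and chain
  rules need this because their derivatives combine derivatives with undifferentiated maps.\<close>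

lemma Ck_on_SucD: "Ck_on (Suc k) S f \<Longrightarrow> Ck_on k S f"
proof (induction k arbitrary: f)
  case 0
  then show ?case
    by (metis Ck_on.simps(1) Ck_on_SucE continuous_at_imp_continuous_on has_derivative_continuous)
next
  case (Suc k)
  obtain D where D: "\<And>x. x \<in> S \<Longrightarrow> (f has_derivative D x) (at x)" "\<And>v. Ck_on (Suc k) S (\<lambda>x. D x v)"
    using Ck_on_SucE[OF Suc.prems] by blast
  show ?case by (rule Ck_on_SucI[OF D(1) Suc.IH[OF D(2)]])
qed

lemma Ck_on_const: "Ck_on k S (\<lambda>x. c)"
proof (induction k arbitrary: c)
  case (Suc k)
  then show ?case by (intro Ck_on_SucI[where D = "\<lambda>x v. 0"] has_derivative_const)
qed simp

lemma Ck_on_id: "Ck_on k S (\<lambda>x. x)"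
proof (cases k)
  case (Suc l)
  then show ?thesis
    using Ck_on_SucI[where D = "\<lambda>x v. v", OF has_derivative_ident Ck_on_const] by blast
qed simp

lemma Ck_on_bounded_linear: "bounded_linear L \<Longrightarrow> Ck_on k S f \<Longrightarrow> Ck_on k S (\<lambda>x. L (f x))"
proof (induction k arbitrary: f)
  case 0
  then show ?case by (simp add: bounded_linear.continuous_on)
next
  case (Suc k)
  obtain D where D: "\<And>x. x \<in> S \<Longrightarrow> (f has_derivative D x) (at x)" "\<And>v. Ck_on k S (\<lambda>x. D x v)"
    using Ck_on_SucE[OF Suc.prems(2)] by blast
  show ?case
    by (rule Ck_on_SucI[where D = "\<lambda>x v. L (D x v)"])
      (auto intro: D Suc.IH Suc.prems(1) bounded_linear.has_derivative[OF Suc.prems(1)])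
qed

lemma Ck_on_add: "Ck_on k S f \<Longrightarrow> Ck_on k S g \<Longrightarrow> Ck_on k S (\<lambda>x. f x + g x)"
proof (induction k arbitrary: f g)
  case 0
  then show ?case by (simp add: continuous_on_add)
next
  case (Suc k)
  obtain D where D: "\<And>x. x \<in> S \<Longrightarrow> (f has_derivative D x) (at x)" "\<And>v. Ck_on k S (\<lambda>x. D x v)"
    using Ck_on_SucE[OF Suc.prems(1)] by blast
  obtain E where E: "\<And>x. x \<in> S \<Longrightarrow> (g has_derivative E x) (at x)" "\<And>v. Ck_on k S (\<lambda>x. E x v)"
    using Ck_on_SucE[OF Suc.prems(2)] by blast
  show ?case
    by (rule Ck_on_SucI[where D = "\<lambda>x v. D x v + E x v"]) (auto intro: D E Suc.IH has_derivative_add)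
qed

lemma Ck_on_sum: "(\<And>i. i \<in> I \<Longrightarrow> Ck_on k S (f i)) \<Longrightarrow> Ck_on k S (\<lambda>x. \<Sum>i\<in>I. f i x)"
  by (induction I rule: infinite_finite_induct) (simp_all add: Ck_on_const Ck_on_add)

lemma Ck_on_bounded_bilinear:
  assumes "bounded_bilinear m"
  shows "Ck_on k S f \<Longrightarrow> Ck_on k S g \<Longrightarrow> Ck_on k S (\<lambda>x. m (f x) (g x))"
proof (induction k arbitrary: f g)
  case 0
  then show ?case using assms by (simp add: bounded_bilinear.continuous_on)
next
  case (Suc k)
  obtain D where D: "\<And>x. x \<in> S \<Longrightarrow> (f has_derivative D x) (at x)" "\<And>v. Ck_on k S (\<lambda>x. D x v)"
    using Ck_on_SucE[OF Suc.prems(1)] by blast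
  obtain E where E: "\<And>x. x \<in> S \<Longrightarrow> (g has_derivative E x) (at x)" "\<And>v. Ck_on k S (\<lambda>x. E x v)"
    using Ck_on_SucE[OF Suc.prems(2)] by blast
  show ?case
  proof (rule Ck_on_SucI[where D = "\<lambda>x v. m (f x) (E x v) + m (D x v) (g x)"])
    show "((\<lambda>x. m (f x) (g x)) has_derivative (\<lambda>v. m (f x) (E x v) + m (D x v) (g x))) (at x)"
      if "x \<in> S" for x
      using that by (intro bounded_bilinear.FDERIV[OF assms] D E)
    show "Ck_on k S (\<lambda>x. m (f x) (E x v) + m (D x v) (g x))" for v
      \<comment> \<open>In each summand the undifferentiated factor is lowered from order k+1 to k,
        so that the induction hypothesis covers both products.\<close>
      using Suc.IH[OF Ck_on_SucD[OF Suc.prems(1)] E(2)] Suc.IH[OF D(2) Ck_on_SucD[OF Suc.prems(2)]]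
      by (rule Ck_on_add)
  qed
qed

lemma Ck_on_Pair: "Ck_on k S f \<Longrightarrow> Ck_on k S g \<Longrightarrow> Ck_on k S (\<lambda>x. (f x, g x))"
proof (induction k arbitrary: f g)
  case 0
  then show ?case by (simp add: continuous_on_Pair)
next
  case (Suc k)
  obtain D where D: "\<And>x. x \<in> S \<Longrightarrow> (f has_derivative D x) (at x)" "\<And>v. Ck_on k S (\<lambda>x. D x v)"
    using Ck_on_SucE[OF Suc.prems(1)] by blast
  obtain E where E: "\<And>x. x \<in> S \<Longrightarrow> (g has_derivative E x) (at x)" "\<And>v. Ck_on k S (\<lambda>x. E x v)"
    using Ck_on_SucE[OF Suc.prems(2)] by blast
  show ?case
    by (rule Ck_on_SucI[where D = "\<lambda>x v. (D x v, E x v)"]) (auto intro: D E Suc.IH has_derivative_Pair)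
qed

text \<open>
  The definition of \<^const>\<open>Ck_on\<close> controls \<open>x \<mapsto> D x v\<close> only for a fixed direction \<open>v\<close>,
  whereas the chain rule produces \<open>x \<mapsto> D (f x) (E x v)\<close>; expanding \<open>E x v\<close> in an orthogonal
  spanning set reduces the latter to sums of products. This needs finite dimension.
\<close>

lemma Ck_on_compose:
  fixes f :: "'a::real_normed_vector \<Rightarrow> 'b::real_inner" and g :: "'b \<Rightarrow> 'c::real_normed_vector"
  assumes "finite B" and "span B = (UNIV :: 'b set)" and fS: "f ` S \<subseteq> T"
  shows "Ck_on k S f \<Longrightarrow> Ck_on k T g \<Longrightarrow> Ck_on k S (\<lambda>x. g (f x))"
proof (induction k arbitrary: g)
  case 0
  with fS show ?case by (simp add: continuous_on_compose2)
next
  case (Suc k)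
  \<comment> \<open>Gram-Schmidt orthogonalization of \<open>B\<close>; the explicit coefficients in
    the expansion require orthogonality.\<close>
  obtain C :: "'b set" where C: "finite C" "span C = UNIV" "pairwise orthogonal C"
    using basis_orthogonal[OF assms(1)] assms(2) by auto
  from Suc.prems obtain D E where D: "\<forall>x\<in>S. (f has_derivative D x) (at x)" "\<forall>v. Ck_on k S (\<lambda>x. D x v)"
    and E: "\<forall>y\<in>T. (g has_derivative E y) (at y)" "\<forall>v. Ck_on k T (\<lambda>y. E y v)"
    by auto
  let ?F = "\<lambda>x v. \<Sum>b\<in>C. ((D x v \<bullet> b) / (b \<bullet> b)) *\<^sub>R E (f x) b"
  have "((\<lambda>x. g (f x)) has_derivative ?F x) (at x)" if x: "x \<in> S" for x
  proof -
    have gd: "(g has_derivative E (f x)) (at (f x))" using E(1) fS x by blast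
    then have lin: "linear (E (f x))" by (rule has_derivative_linear)
    have "E (f x) (D x v) = ?F x v" for v
      by (subst (1) orthogonal_spanning_set_expansion[OF C(1,3,2), of "D x v", symmetric])
        (simp add: linear_sum[OF lin] linear_scale[OF lin])
    then have "(\<lambda>v. E (f x) (D x v)) = ?F x" by blast
    with has_derivative_compose[OF D(1)[rule_format, OF x] gd] show ?thesis by simp
  qed
  moreover have "Ck_on k S (\<lambda>x. ?F x v)" for v
  proof (intro Ck_on_sum Ck_on_bounded_bilinear[OF bounded_bilinear_scaleR])
    fix b assume "b \<in> C"
    \<comment> \<open>For fixed \<open>b\<close> the coefficient is a bounded linear functional of
      \<open>D x v\<close>, so it inherits class C^k in \<open>x\<close>.\<close>
    have "bounded_linear (\<lambda>w. (w \<bullet> b) / (b \<bullet> b))"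
      using bounded_linear_inner_left[of "b /\<^sub>R (b \<bullet> b)"] by (simp add: divide_inverse mult.commute)
    then show "Ck_on k S (\<lambda>x. (D x v \<bullet> b) / (b \<bullet> b))"
      using D(2) Ck_on_bounded_linear by fastforce
    \<comment> \<open>The direction \<open>b\<close> no longer depends on \<open>x\<close>, so this
      is a composite of \<open>f\<close> with the C^k map \<open>E _ b\<close>: the induction
      hypothesis for a new outer map.\<close>
    show "Ck_on k S (\<lambda>x. E (f x) b)"
      using Suc.IH[OF Ck_on_SucD[OF Suc.prems(1)]] E(2) by blast
  qed
  ultimately show ?case by (rule Ck_on_SucI)
qed

section \<open>Smooth maps and products of manifolds\<close>

lemma smooth_on_subset: "smooth_on S f \<Longrightarrow> T \<subseteq> S \<Longrightarrow> smooth_on T f"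
  unfolding smooth_on_def using Ck_on_subset by blast

lemma smooth_on_cong:
  "open S \<Longrightarrow> (\<And>x. x \<in> S \<Longrightarrow> f x = g x) \<Longrightarrow> smooth_on S f \<Longrightarrow> smooth_on S g"
  unfolding smooth_on_def using Ck_on_cong[of S f g] by blast

lemma smooth_on_locally:
  "(\<And>x. x \<in> S \<Longrightarrow> \<exists>T. open T \<and> x \<in> T \<and> smooth_on T f) \<Longrightarrow> smooth_on S f"
  unfolding smooth_on_def by (intro allI Ck_on_locally) meson

lemma smooth_on_bounded_linear: "bounded_linear L \<Longrightarrow> smooth_on S L"
  unfolding smooth_on_def using Ck_on_bounded_linear[OF _ Ck_on_id] by blast

lemma smooth_on_Pair: "smooth_on S f \<Longrightarrow> smooth_on S g \<Longrightarrow> smooth_on S (\<lambda>x. (f x, g x))"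
  unfolding smooth_on_def by (blast intro: Ck_on_Pair)

text \<open>Finite dimension of the middle space is an explicit hypothesis because the class
  \<open>real_inner\<close> does not imply it; for model spaces of manifolds
  \<open>smooth_manifold_finite_dim\<close> provides it.\<close>

lemma smooth_on_compose:
  fixes f :: "'a::real_inner \<Rightarrow> 'b::real_inner" and g :: "'b \<Rightarrow> 'c::real_inner"
  assumes "\<exists>B :: 'b set. finite B \<and> span B = UNIV"
    and "smooth_on S f" and "smooth_on T g" and "f ` S \<subseteq> T"
  shows "smooth_on S (\<lambda>x. g (f x))"
proof -
  obtain B :: "'b set" where "finite B" "span B = UNIV" using assms(1) by blast
  with assms show ?thesis
    unfolding smooth_on_def using Ck_on_compose[of B f S T] by blast
qed

section \<open>Charts of a manifold\<close>

lemma smooth_manifold_finite_dim: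
  fixes M :: "('a, 'e::real_inner) manifold"
  shows "smooth_manifold M \<Longrightarrow> \<exists>B :: 'e set. finite B \<and> span B = UNIV"
  unfolding smooth_manifold_def by blast

lemma chart_exists:
  assumes "smooth_manifold M" and "p \<in> points M"
  obtains U \<phi> where "(U, \<phi>) \<in> atlas M" and "p \<in> U"
proof -
  have "p \<in> (\<Union>(U, \<phi>)\<in>atlas M. U)" using assms unfolding smooth_manifold_def by blast
  with that show ?thesis by blast
qed

lemma chart_transition:
  assumes "smooth_manifold M" and "(U, \<phi>) \<in> atlas M" and "(V, \<psi>) \<in> atlas M"
  shows "smooth_on (\<phi> ` (U \<inter> V)) (\<psi> \<circ> inv_into U \<phi>)"
  using assms by (auto simp: smooth_manifold_def)

context
  fixes M :: "('a, 'e::real_inner) manifold" and U :: "'a set" and \<phi> :: "'a \<Rightarrow> 'e"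
  assumes M: "smooth_manifold M" and chart: "(U, \<phi>) \<in> atlas M"
begin

lemma chart_domain_open: "openin (mtop M) U"
  using M chart by (auto simp: smooth_manifold_def)

lemma chart_homeomorphic: "homeomorphic_map (subtopology (mtop M) U) (top_of_set (\<phi> ` U)) \<phi>"
  using M chart by (auto simp: smooth_manifold_def)

lemma chart_domain_subset: "U \<subseteq> points M"
  using chart_domain_open openin_subset by blast

lemma chart_inj_on: "inj_on \<phi> U"
  using homeomorphic_imp_injective_map[OF chart_homeomorphic] chart_domain_subset
  by (simp add: Int_absorb1)

text \<open>A chart is an open map onto its image with the subspace topology, and that image is
  itself open in the model space.\<close>

lemma chart_image_open:
  assumes "openin (mtop M) W" and "W \<subseteq> U"
  shows "open (\<phi> ` W)"
proof -
  have "openin (subtopology (mtop M) U) W"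
    using assms by (simp add: chart_domain_open openin_open_subtopology)
  then have "openin (top_of_set (\<phi> ` U)) (\<phi> ` W)"
    using homeomorphic_imp_open_map[OF chart_homeomorphic] by (simp add: open_map_def)
  moreover have "open (\<phi> ` U)" using M chart by (auto simp: smooth_manifold_def)
  ultimately show ?thesis by (simp add: openin_open_trans)
qed

end

text \<open>Continuity controls preimages only inside \<open>points M\<close>; as \<open>U\<close>
  lies there, the raw preimage occurring in \<open>smooth_map\<close> is open as well.\<close>

lemma chart_preimage_open:
  assumes "smooth_manifold M" and "(U, \<phi>) \<in> atlas M"
    and "continuous_map (mtop M) X f" and "openin X V"
  shows "openin (mtop M) (U \<inter> f -` V)"
proof -
  have "openin (mtop M) (U \<inter> {x \<in> points M. f x \<in> V})"
    using assms by (intro openin_Int chart_domain_open openin_continuous_map_preimage)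
  moreover have "U \<inter> {x \<in> points M. f x \<in> V} = U \<inter> f -` V"
    using chart_domain_subset[OF assms(1,2)] by auto
  ultimately show ?thesis by simp
qed

section \<open>Smooth maps between manifolds and their composition\<close>

lemma smooth_map_continuous: "smooth_map M N f \<Longrightarrow> continuous_map (mtop M) (mtop N) f"
  unfolding smooth_map_def by blast

lemma smooth_map_charts:
  "smooth_map M N f \<Longrightarrow> (U, \<phi>) \<in> atlas M \<Longrightarrow> (V, \<psi>) \<in> atlas N \<Longrightarrow>
    smooth_on (\<phi> ` (U \<inter> f -` V)) (\<psi> \<circ> f \<circ> inv_into U \<phi>)"
  unfolding smooth_map_def by blast

lemma smooth_mapI:
  assumes "continuous_map (mtop M) (mtop N) f"
    and "\<And>U \<phi> V \<psi>. (U, \<phi>) \<in> atlas M \<Longrightarrow> (V, \<psi>) \<in> atlas N \<Longrightarrow>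
      smooth_on (\<phi> ` (U \<inter> f -` V)) (\<psi> \<circ> f \<circ> inv_into U \<phi>)"
  shows "smooth_map M N f"
  using assms unfolding smooth_map_def by blast

text \<open>The image of a chart domain under \<open>f\<close> may lie in no single chart of
  \<open>N\<close>. Near each point a chart of \<open>N\<close> around its image is chosen, and
  there the coordinate expression of the composite factors through that chart.\<close>

lemma smooth_map_compose:
  assumes M: "smooth_manifold M" and N: "smooth_manifold N" and K: "smooth_manifold K"
    and f: "smooth_map M N f" and g: "smooth_map N K g"
  shows "smooth_map M K (\<lambda>x. g (f x))"
proof (rule smooth_mapI)
  show "continuous_map (mtop M) (mtop K) (\<lambda>x. g (f x))"
    using continuous_map_compose[OF f[THEN smooth_map_continuous] g[THEN smooth_map_continuous]]
    by (simp add: o_def)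
next
  fix U \<phi> W \<kappa>
  assume U: "(U, \<phi>) \<in> atlas M" and W: "(W, \<kappa>) \<in> atlas K"
  show "smooth_on (\<phi> ` (U \<inter> (\<lambda>x. g (f x)) -` W)) (\<kappa> \<circ> (\<lambda>x. g (f x)) \<circ> inv_into U \<phi>)"
  proof (rule smooth_on_locally)
    fix x assume "x \<in> \<phi> ` (U \<inter> (\<lambda>x. g (f x)) -` W)"
    then obtain p where p: "x = \<phi> p" "p \<in> U" "g (f p) \<in> W" by blast
    then have "f p \<in> points N"
      using chart_domain_subset[OF M U] smooth_map_continuous[OF f]
      by (auto simp: continuous_map_def)
    then obtain V \<psi> where V: "(V, \<psi>) \<in> atlas N" and fp: "f p \<in> V"
      using chart_exists[OF N] by blast
    \<comment> \<open>The coordinates of those points where both coordinate expressions, through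
      \<open>V\<close> and then into \<open>W\<close>, are meaningful.\<close>
    let ?T = "\<phi> ` (U \<inter> f -` (V \<inter> g -` W))"
    have "openin (mtop N) (V \<inter> g -` W)"
      by (rule chart_preimage_open[OF N V smooth_map_continuous[OF g] chart_domain_open[OF K W]])
    then have "openin (mtop M) (U \<inter> f -` (V \<inter> g -` W))"
      by (rule chart_preimage_open[OF M U smooth_map_continuous[OF f]])
    then have T: "open ?T"
      by (rule chart_image_open[OF M U]) blast
    have inv\<phi>: "inv_into U \<phi> (\<phi> q) = q" if "q \<in> U" for q
      using chart_inj_on[OF M U] that by simp
    have inv\<psi>: "inv_into V \<psi> (\<psi> q) = q" if "q \<in> V" for q
      using chart_inj_on[OF N V] that by simp
    have "smooth_on ?T (\<lambda>y. (\<kappa> \<circ> g \<circ> inv_into V \<psi>) ((\<psi> \<circ> f \<circ> inv_into U \<phi>) y))"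
    proof (rule smooth_on_compose[OF smooth_manifold_finite_dim[OF N]])
      show "smooth_on ?T (\<psi> \<circ> f \<circ> inv_into U \<phi>)"
        by (rule smooth_on_subset[OF smooth_map_charts[OF f U V]]) blast
      show "smooth_on (\<psi> ` (V \<inter> g -` W)) (\<kappa> \<circ> g \<circ> inv_into V \<psi>)"
        by (rule smooth_map_charts[OF g V W])
      show "(\<psi> \<circ> f \<circ> inv_into U \<phi>) ` ?T \<subseteq> \<psi> ` (V \<inter> g -` W)"
        using inv\<phi> by auto
    qed
    \<comment> \<open>On \<open>?T\<close> the inserted pair of \<open>\<psi>\<close> and its
      inverse cancels; openness of \<open>?T\<close> permits replacing one expression by the
      other.\<close>
    then have "smooth_on ?T (\<kappa> \<circ> (\<lambda>x. g (f x)) \<circ> inv_into U \<phi>)"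
      by (rule smooth_on_cong[OF T, rotated]) (auto simp: inv\<phi> inv\<psi>)
    moreover have "x \<in> ?T" using p fp by auto
    ultimately show "\<exists>T. open T \<and> x \<in> T \<and> smooth_on T (\<kappa> \<circ> (\<lambda>x. g (f x)) \<circ> inv_into U \<phi>)"
      using T by blast
  qed
qed

section \<open>Products of manifolds, pairings and projections\<close>

lemma mtop_prod [simp]: "mtop (M \<times>\<^sub>M N) = prod_topology (mtop M) (mtop N)"
  by (simp add: prod_manifold_def)

lemma atlas_prodE:
  assumes "(W, \<kappa>) \<in> atlas (M \<times>\<^sub>M N)"
  obtains U \<phi> V \<psi> where "W = U \<times> V" "\<kappa> = map_prod \<phi> \<psi>" "(U, \<phi>) \<in> atlas M" "(V, \<psi>) \<in> atlas N"
  using assms unfolding prod_manifold_def by auto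

text \<open>Injectivity makes preimages unique, so the chosen inverse of a product chart can be
  computed factor by factor.\<close>

lemma inv_into_map_prod:
  assumes "inj_on f A" and "inj_on g B" and "x \<in> f ` A" and "y \<in> g ` B"
  shows "inv_into (A \<times> B) (map_prod f g) (x, y) = (inv_into A f x, inv_into B g y)"
  using assms by (intro inv_into_f_eq map_prod_inj_on) (auto simp: inv_into_into f_inv_into_f)

lemma smooth_map_Pair:
  assumes f: "smooth_map M N f" and g: "smooth_map M K g"
  shows "smooth_map M (N \<times>\<^sub>M K) (\<lambda>x. (f x, g x))"
proof (rule smooth_mapI)
  show "continuous_map (mtop M) (mtop (N \<times>\<^sub>M K)) (\<lambda>x. (f x, g x))"
    using f g by (simp add: smooth_map_continuous continuous_map_paired)
next
  fix U \<phi> W \<kappa>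
  assume U: "(U, \<phi>) \<in> atlas M" and W: "(W, \<kappa>) \<in> atlas (N \<times>\<^sub>M K)"
  obtain V \<psi> V' \<psi>' where W_eq: "W = V \<times> V'" "\<kappa> = map_prod \<psi> \<psi>'"
    and V: "(V, \<psi>) \<in> atlas N" and V': "(V', \<psi>') \<in> atlas K"
    by (rule atlas_prodE[OF W])
  have "smooth_on (\<phi> ` (U \<inter> (\<lambda>x. (f x, g x)) -` W))
    (\<lambda>x. ((\<psi> \<circ> f \<circ> inv_into U \<phi>) x, (\<psi>' \<circ> g \<circ> inv_into U \<phi>) x))"
    unfolding W_eq
    by (intro smooth_on_Pair smooth_on_subset[OF smooth_map_charts[OF f U V]]
        smooth_on_subset[OF smooth_map_charts[OF g U V']]) auto
  then show "smooth_on (\<phi> ` (U \<inter> (\<lambda>x. (f x, g x)) -` W))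
    (\<kappa> \<circ> (\<lambda>x. (f x, g x)) \<circ> inv_into U \<phi>)"
    by (simp add: W_eq o_def)
qed

text \<open>In a product chart the projection becomes the linear projection of model spaces followed
  by a transition map of \<open>M\<close>, since the target chart \<open>U'\<close> may differ from
  the factor \<open>U\<close>.\<close>

lemma smooth_map_fst:
  assumes M: "smooth_manifold M" and N: "smooth_manifold N"
  shows "smooth_map (M \<times>\<^sub>M N) M fst"
proof (rule smooth_mapI)
  show "continuous_map (mtop (M \<times>\<^sub>M N)) (mtop M) fst"
    by (simp add: continuous_map_fst)
next
  fix W \<kappa> U' \<phi>'
  assume W: "(W, \<kappa>) \<in> atlas (M \<times>\<^sub>M N)" and U': "(U', \<phi>') \<in> atlas M"
  obtain U \<phi> V \<psi> where W_eq: "W = U \<times> V" "\<kappa> = map_prod \<phi> \<psi>"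
    and U: "(U, \<phi>) \<in> atlas M" and V: "(V, \<psi>) \<in> atlas N"
    by (rule atlas_prodE[OF W])
  have dom: "\<kappa> ` (W \<inter> fst -` U') = \<phi> ` (U \<inter> U') \<times> \<psi> ` V"
    by (force simp: W_eq)
  have "openin (mtop M) (U \<inter> U')"
    by (intro openin_Int chart_domain_open[OF M U] chart_domain_open[OF M U'])
  then have op: "open (\<phi> ` (U \<inter> U') \<times> \<psi> ` V)"
    by (intro open_Times chart_image_open[OF M U] chart_image_open[OF N V]
        chart_domain_open[OF N V]) auto
  have "smooth_on (\<phi> ` (U \<inter> U') \<times> \<psi> ` V) (\<lambda>z. (\<phi>' \<circ> inv_into U \<phi>) (fst z))"
    by (rule smooth_on_compose[OF smooth_manifold_finite_dim[OF M]
          smooth_on_bounded_linear[OF bounded_linear_fst] chart_transition[OF M U U']]) auto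
  then show "smooth_on (\<kappa> ` (W \<inter> fst -` U')) (\<phi>' \<circ> fst \<circ> inv_into W \<kappa>)"
    unfolding dom
    by (rule smooth_on_cong[OF op, rotated])
      (auto simp: W_eq inv_into_map_prod chart_inj_on[OF M U] chart_inj_on[OF N V])
qed

lemma smooth_map_snd:
  assumes M: "smooth_manifold M" and N: "smooth_manifold N"
  shows "smooth_map (M \<times>\<^sub>M N) N snd"
proof (rule smooth_mapI)
  show "continuous_map (mtop (M \<times>\<^sub>M N)) (mtop N) snd"
    by (simp add: continuous_map_snd)
next
  fix W \<kappa> V' \<psi>'
  assume W: "(W, \<kappa>) \<in> atlas (M \<times>\<^sub>M N)" and V': "(V', \<psi>') \<in> atlas N"
  obtain U \<phi> V \<psi> where W_eq: "W = U \<times> V" "\<kappa> = map_prod \<phi> \<psi>"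
    and U: "(U, \<phi>) \<in> atlas M" and V: "(V, \<psi>) \<in> atlas N"
    by (rule atlas_prodE[OF W])
  have dom: "\<kappa> ` (W \<inter> snd -` V') = \<phi> ` U \<times> \<psi> ` (V \<inter> V')"
    by (force simp: W_eq)
  have "openin (mtop N) (V \<inter> V')"
    by (intro openin_Int chart_domain_open[OF N V] chart_domain_open[OF N V'])
  then have op: "open (\<phi> ` U \<times> \<psi> ` (V \<inter> V'))"
    by (intro open_Times chart_image_open[OF M U] chart_image_open[OF N V]
        chart_domain_open[OF M U]) auto
  have "smooth_on (\<phi> ` U \<times> \<psi> ` (V \<inter> V')) (\<lambda>z. (\<psi>' \<circ> inv_into V \<psi>) (snd z))"
    by (rule smooth_on_compose[OF smooth_manifold_finite_dim[OF N]
          smooth_on_bounded_linear[OF bounded_linear_snd] chart_transition[OF N V V']]) auto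
  then show "smooth_on (\<kappa> ` (W \<inter> snd -` V')) (\<psi>' \<circ> snd \<circ> inv_into W \<kappa>)"
    unfolding dom
    by (rule smooth_on_cong[OF op, rotated])
      (auto simp: W_eq inv_into_map_prod chart_inj_on[OF M U] chart_inj_on[OF N V])
qed

text \<open>The two coordinate inclusions carry \<open>B\<close> and \<open>C\<close> to sets
  spanning the two axes, and each vector is the sum of its components on the axes.\<close>

lemma finite_spanning_set_prod:
  fixes B :: "'a::real_vector set" and C :: "'b::real_vector set"
  assumes "finite B" "span B = UNIV" and "finite C" "span C = UNIV"
  shows "\<exists>A :: ('a \<times> 'b) set. finite A \<and> span A = UNIV"
proof -
  let ?A = "(\<lambda>x. (x, 0)) ` B \<union> (\<lambda>y. (0, y)) ` C"
  have "linear (\<lambda>x::'a. (x, 0::'b))" by (auto intro!: linearI)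
  then have 1: "(x, 0::'b) \<in> span ((\<lambda>x. (x, 0)) ` B)" for x
    using assms(2) by (simp add: linear_span_image)
  have "linear (\<lambda>y::'b. (0::'a, y))" by (auto intro!: linearI)
  then have 2: "(0::'a, y) \<in> span ((\<lambda>y. (0, y)) ` C)" for y
    using assms(4) by (simp add: linear_span_image)
  have "(x, 0) + (0, y) \<in> span ?A" for x y
    using 1 2 span_mono[of "(\<lambda>x. (x, 0)) ` B" ?A] span_mono[of "(\<lambda>y. (0, y)) ` C" ?A]
    by (intro span_add) auto
  then have "z \<in> span ?A" for z by (cases z) simp
  then have "finite ?A \<and> span ?A = UNIV" using assms(1,3) by auto
  then show ?thesis by (rule exI)
qed

text \<open>Boxes formed from two countable bases are a countable base, because each point of an
  open set of the product has an open box inside that set.\<close>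

lemma second_countable_prod_topology:
  assumes "second_countable X" and "second_countable Y"
  shows "second_countable (prod_topology X Y)"
proof -
  obtain \<B> where \<B>: "countable \<B>" "\<forall>V\<in>\<B>. openin X V"
    "\<forall>U x. openin X U \<and> x \<in> U \<longrightarrow> (\<exists>V\<in>\<B>. x \<in> V \<and> V \<subseteq> U)"
    using assms(1) unfolding second_countable_def by (elim exE conjE)
  obtain \<C> where \<C>: "countable \<C>" "\<forall>V\<in>\<C>. openin Y V"
    "\<forall>U x. openin Y U \<and> x \<in> U \<longrightarrow> (\<exists>V\<in>\<C>. x \<in> V \<and> V \<subseteq> U)"
    using assms(2) unfolding second_countable_def by (elim exE conjE)
  let ?\<D> = "(\<lambda>(B, C). B \<times> C) ` (\<B> \<times> \<C>)"
  have "\<exists>V\<in>?\<D>. z \<in> V \<and> V \<subseteq> W" if W: "openin (prod_topology X Y) W" and z: "z \<in> W" for W z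
  proof -
    obtain U V where "openin X U" "openin Y V" "fst z \<in> U" "snd z \<in> V" "U \<times> V \<subseteq> W"
      using W z unfolding openin_prod_topology_alt by (metis prod.collapse)
    moreover from this obtain B C where "B \<in> \<B>" "fst z \<in> B" "B \<subseteq> U" "C \<in> \<C>" "snd z \<in> C" "C \<subseteq> V"
      using \<B>(3) \<C>(3) by meson
    ultimately show ?thesis
      by (intro bexI[of _ "B \<times> C"]) (auto simp: mem_Times_iff)
  qed
  moreover have "countable ?\<D>" using \<B>(1) \<C>(1) by blast
  moreover have "\<forall>V\<in>?\<D>. openin (prod_topology X Y) V"
    using \<B>(2) \<C>(2) by (auto simp: openin_prod_Times_iff)
  ultimately show ?thesis unfolding second_countable_def by (intro exI[of _ ?\<D>]) simp
qed

lemma homeomorphic_map_map_prod: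
  assumes "homeomorphic_map X X' f" and "homeomorphic_map Y Y' g"
  shows "homeomorphic_map (prod_topology X Y) (prod_topology X' Y') (map_prod f g)"
proof -
  obtain f' g' where "homeomorphic_maps X X' f f'" "homeomorphic_maps Y Y' g g'"
    using assms by (auto simp: homeomorphic_map_maps)
  then have "homeomorphic_maps (prod_topology X Y) (prod_topology X' Y')
      (\<lambda>(x, y). (f x, g y)) (\<lambda>(x, y). (f' x, g' y))"
    by (simp add: homeomorphic_maps_prod)
  moreover have "(\<lambda>(x, y). (f x, g y)) = map_prod f g" by auto
  ultimately show ?thesis by (auto simp: homeomorphic_map_maps)
qed

text \<open>The composition lemma asks every space involved to be a manifold, and the structure maps
  live on products, some of them iterated. Transition maps of product charts are products of
  transition maps.\<close>

lemma smooth_manifold_prod: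
  fixes M :: "('a, 'e::real_inner) manifold" and N :: "('b, 'f::real_inner) manifold"
  assumes M: "smooth_manifold M" and N: "smooth_manifold N"
  shows "smooth_manifold (M \<times>\<^sub>M N)"
  unfolding smooth_manifold_def
proof (intro conjI)
  show "\<exists>B :: ('e \<times> 'f) set. finite B \<and> span B = UNIV"
    using smooth_manifold_finite_dim[OF M] smooth_manifold_finite_dim[OF N]
      finite_spanning_set_prod by blast
  show "Hausdorff_space (mtop (M \<times>\<^sub>M N))"
    using M N by (simp add: smooth_manifold_def Hausdorff_space_prod_topology)
  show "second_countable (mtop (M \<times>\<^sub>M N))"
    using M N by (simp add: smooth_manifold_def second_countable_prod_topology)
  show "\<forall>(W, \<kappa>)\<in>atlas (M \<times>\<^sub>M N). openin (mtop (M \<times>\<^sub>M N)) W \<and> open (\<kappa> ` W) \<and>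
      homeomorphic_map (subtopology (mtop (M \<times>\<^sub>M N)) W) (top_of_set (\<kappa> ` W)) \<kappa>"
  proof (clarify elim!: atlas_prodE)
    fix U \<phi> V \<psi> assume U: "(U, \<phi>) \<in> atlas M" and V: "(V, \<psi>) \<in> atlas N"
    have img: "map_prod \<phi> \<psi> ` (U \<times> V) = \<phi> ` U \<times> \<psi> ` V" by auto
    have "homeomorphic_map (subtopology (mtop (M \<times>\<^sub>M N)) (U \<times> V)) (top_of_set (\<phi> ` U \<times> \<psi> ` V))
        (map_prod \<phi> \<psi>)"
      using homeomorphic_map_map_prod[OF chart_homeomorphic[OF M U] chart_homeomorphic[OF N V]]
      by (simp add: subtopology_Times)
    then show "openin (mtop (M \<times>\<^sub>M N)) (U \<times> V) \<and> open (map_prod \<phi> \<psi> ` (U \<times> V)) \<and>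
      homeomorphic_map (subtopology (mtop (M \<times>\<^sub>M N)) (U \<times> V))
        (top_of_set (map_prod \<phi> \<psi> ` (U \<times> V))) (map_prod \<phi> \<psi>)"
      unfolding img
      by (simp add: openin_prod_Times_iff open_Times chart_domain_open[OF M U]
          chart_domain_open[OF N V] chart_image_open[OF M U] chart_image_open[OF N V])
  qed
  show "(\<Union>(W, \<kappa>)\<in>atlas (M \<times>\<^sub>M N). W) = points (M \<times>\<^sub>M N)"
  proof (intro equalityI subsetI)
    fix z assume "z \<in> (\<Union>(W, \<kappa>)\<in>atlas (M \<times>\<^sub>M N). W)"
    then show "z \<in> points (M \<times>\<^sub>M N)"
      using chart_domain_subset[OF M] chart_domain_subset[OF N] by (fastforce elim!: atlas_prodE)
  next
    fix z assume "z \<in> points (M \<times>\<^sub>M N)"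
    then have "fst z \<in> points M" "snd z \<in> points N" by (auto simp: mem_Times_iff)
    then obtain U \<phi> V \<psi> where "(U, \<phi>) \<in> atlas M" "fst z \<in> U" "(V, \<psi>) \<in> atlas N" "snd z \<in> V"
      using chart_exists[OF M] chart_exists[OF N] by metis
    then show "z \<in> (\<Union>(W, \<kappa>)\<in>atlas (M \<times>\<^sub>M N). W)"
      unfolding prod_manifold_def
      by (intro UN_I[of "(U \<times> V, map_prod \<phi> \<psi>)"]) (auto simp: mem_Times_iff)
  qed
  show "\<forall>(W, \<kappa>)\<in>atlas (M \<times>\<^sub>M N). \<forall>(W', \<kappa>')\<in>atlas (M \<times>\<^sub>M N).
      smooth_on (\<kappa> ` (W \<inter> W')) (\<kappa>' \<circ> inv_into W \<kappa>)"
  proof (clarify elim!: atlas_prodE)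
    fix U \<phi> V \<psi> U' \<phi>' V' \<psi>'
    assume U: "(U, \<phi>) \<in> atlas M" and V: "(V, \<psi>) \<in> atlas N"
      and U': "(U', \<phi>') \<in> atlas M" and V': "(V', \<psi>') \<in> atlas N"
    \<comment> \<open>Boxes intersect in a box, so the overlap splits into overlaps of the
      factors.\<close>
    have dom: "map_prod \<phi> \<psi> ` (U \<times> V \<inter> U' \<times> V') = \<phi> ` (U \<inter> U') \<times> \<psi> ` (V \<inter> V')"
      by auto
    have op: "open (\<phi> ` (U \<inter> U') \<times> \<psi> ` (V \<inter> V'))"
      by (intro open_Times chart_image_open[OF M U] chart_image_open[OF N V] openin_Int
          chart_domain_open[OF M U] chart_domain_open[OF M U']
          chart_domain_open[OF N V] chart_domain_open[OF N V']) auto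
    have "smooth_on (\<phi> ` (U \<inter> U') \<times> \<psi> ` (V \<inter> V'))
        (\<lambda>z. ((\<phi>' \<circ> inv_into U \<phi>) (fst z), (\<psi>' \<circ> inv_into V \<psi>) (snd z)))"
      by (intro smooth_on_Pair
          smooth_on_compose[OF smooth_manifold_finite_dim[OF M]
            smooth_on_bounded_linear[OF bounded_linear_fst] chart_transition[OF M U U']]
          smooth_on_compose[OF smooth_manifold_finite_dim[OF N]
            smooth_on_bounded_linear[OF bounded_linear_snd] chart_transition[OF N V V']]) auto
    then show "smooth_on (map_prod \<phi> \<psi> ` (U \<times> V \<inter> U' \<times> V'))
        (map_prod \<phi>' \<psi>' \<circ> inv_into (U \<times> V) (map_prod \<phi> \<psi>))"
      unfolding dom
      by (rule smooth_on_cong[OF op, rotated])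
        (auto simp: inv_into_map_prod chart_inj_on[OF M U] chart_inj_on[OF N V])
  qed
qed

text \<open>Substitution into a binary operation, such as multiplication or a group action; its
  repeated use builds the ternary operation and the semiheap action.\<close>

lemma smooth_map_compose2:
  assumes "smooth_manifold M" "smooth_manifold N" "smooth_manifold K" "smooth_manifold L"
    and "smooth_map (N \<times>\<^sub>M K) L (\<lambda>(x, y). h x y)"
    and "smooth_map M N f" and "smooth_map M K g"
  shows "smooth_map M L (\<lambda>x. h (f x) (g x))"
  using smooth_map_compose[OF assms(1) smooth_manifold_prod[OF assms(2,3)] assms(4)
      smooth_map_Pair[OF assms(6,7)] assms(5)] by simp

section \<open>Semiheaps of groups and associated bundles\<close>

lemma group_semiheap_simps [simp]:
  "smfd (group_semiheap G) = gmfd G"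
  "tern (group_semiheap G) x y z = x \<otimes>\<^bsub>G\<^esub> inv\<^bsub>G\<^esub> y \<otimes>\<^bsub>G\<^esub> z"
  by (simp_all add: group_semiheap_def)

text \<open>Inversion reverses products, so the inverse of \<open>[x4, x3, x2]\<close> is the
  product of x2^-1, x3, x4^-1. All three bracketings therefore equal x1 x2^-1 x3 x4^-1 x5.\<close>

lemma lie_semiheap_group_semiheap:
  assumes "lie_group G"
  shows "lie_semiheap (group_semiheap G)"
proof -
  interpret group G using assms by (simp add: lie_group_def)
  have G: "smooth_manifold (gmfd G)" and carr: "points (gmfd G) = carrier G"
    and mult: "smooth_map (gmfd G \<times>\<^sub>M gmfd G) (gmfd G) (\<lambda>(x, y). x \<otimes>\<^bsub>G\<^esub> y)"
    and inv: "smooth_map (gmfd G) (gmfd G) (\<lambda>x. inv\<^bsub>G\<^esub> x)"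
    using assms by (simp_all add: lie_group_def)
  let ?G = "gmfd G"
  note GG = smooth_manifold_prod[OF G G]
  note GGG = smooth_manifold_prod[OF G GG]
  \<comment> \<open>With the arguments written as projections of \<open>w\<close>, the map is
    visibly built by composition. The \<open>OF\<close> instances below fix the intermediate
    manifolds, which the conclusions of the composition rules do not determine.\<close>
  have "smooth_map (?G \<times>\<^sub>M ?G \<times>\<^sub>M ?G) ?G
      (\<lambda>w. fst w \<otimes>\<^bsub>G\<^esub> inv\<^bsub>G\<^esub> (fst (snd w)) \<otimes>\<^bsub>G\<^esub> snd (snd w))"
    by (intro smooth_map_compose2[OF GGG G G G mult] smooth_map_compose[OF GGG G G _ inv]
        smooth_map_compose[OF GGG GG G _ smooth_map_fst[OF G G]]
        smooth_map_compose[OF GGG GG G _ smooth_map_snd[OF G G]]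
        smooth_map_fst[OF G GG] smooth_map_snd[OF G GG])
  then have "smooth_map (?G \<times>\<^sub>M ?G \<times>\<^sub>M ?G) ?G
      (\<lambda>(x, y, z). x \<otimes>\<^bsub>G\<^esub> inv\<^bsub>G\<^esub> y \<otimes>\<^bsub>G\<^esub> z)"
    by (simp add: case_prod_unfold)
  then show ?thesis
    by (simp add: lie_semiheap_def G carr m_assoc inv_mult_group)
qed

text \<open>A homomorphism of groups respects inverses as well as products, hence the word x y^-1
  z.\<close>

lemma lie_semiheap_hom_group_semiheap:
  assumes "lie_group_hom G H \<psi>"
  shows "lie_semiheap_hom (group_semiheap G) (group_semiheap H) \<psi>"
proof -
  have GH: "lie_group G" "lie_group H" "smooth_map (gmfd G) (gmfd H) \<psi>" "\<psi> \<in> hom G H"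
    using assms by (simp_all add: lie_group_hom_def)
  interpret group_hom G H \<psi>
    using GH by (simp add: group_hom_def group_hom_axioms_def lie_group_def)
  have "points (gmfd G) = carrier G" using GH(1) by (simp add: lie_group_def)
  with GH show ?thesis
    by (simp add: lie_semiheap_hom_def lie_semiheap_group_semiheap)
qed

text \<open>The predicates on fibred manifolds read only total space, base and projection, which the
  two bundles share. Trivializations and bundle maps thus carry over unchanged.\<close>

lemma associated_semiheap_bundle_simps [simp]:
  "total (associated_semiheap_bundle B) = total B"
  "base (associated_semiheap_bundle B) = base B"
  "proj (associated_semiheap_bundle B) = proj B"
  "struct_semiheap (associated_semiheap_bundle B) = group_semiheap (struct_group B)"
  "hact (associated_semiheap_bundle B) =
    (\<lambda>p x y. gact B p (inv\<^bsub>struct_group B\<^esub> x \<otimes>\<^bsub>struct_group B\<^esub> y))"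
  "part_over (associated_semiheap_bundle B) U = part_over B U"
  "fibred_manifold (associated_semiheap_bundle B) = fibred_manifold B"
  "local_trivialization (associated_semiheap_bundle B) = local_trivialization B"
  "smooth_bundle_map (associated_semiheap_bundle B) (associated_semiheap_bundle B') =
    smooth_bundle_map B B'"
  by (simp_all add: associated_semiheap_bundle_def part_over_def fibred_manifold_def
      local_trivialization_def smooth_bundle_map_def fun_eq_iff)

text \<open>A trivialization is a bijection onto the product. For a principal bundle this places
  \<open>snd (t p)\<close> in the group, as associativity in the equivariance computation
  requires.\<close>

lemma local_trivialization_snd:
  assumes "local_trivialization B F U t" and "p \<in> part_over B U"
  shows "snd (t p) \<in> points F"
proof -
  have "bij_betw t (points (open_submanifold (total B) (part_over B U)))
      (points (open_submanifold (base B) U \<times>\<^sub>M F))"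
    using assms(1) by (simp add: local_trivialization_def diffeomorphism_def)
  moreover have "p \<in> points (open_submanifold (total B) (part_over B U))"
    using assms(2) by (simp add: open_submanifold_def part_over_def)
  ultimately have "t p \<in> points (open_submanifold (base B) U \<times>\<^sub>M F)"
    using bij_betwE by blast
  then show ?thesis by (simp add: mem_Times_iff)
qed

text \<open>The cover and trivializations of the principal bundle are kept; equivariance under the
  semiheap is their group equivariance at the element x^-1 y, up to associativity.\<close>

lemma semiheap_bundle_associated:
  assumes "principal_bundle B"
  shows "semiheap_bundle (associated_semiheap_bundle B)"
proof -
  define G where "G = struct_group B"
  have fm: "fibred_manifold B" and lie: "lie_group G"
    and act: "smooth_map (total B \<times>\<^sub>M gmfd G) (total B) (\<lambda>(p, g). gact B p g)"
    and assoc: "\<And>p g h. p \<in> points (total B) \<Longrightarrow> g \<in> carrier G \<Longrightarrow> h \<in> carrier G \<Longrightarrow>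
      gact B (gact B p g) h = gact B p (g \<otimes>\<^bsub>G\<^esub> h)"
    and fibre: "\<And>p g. p \<in> points (total B) \<Longrightarrow> g \<in> carrier G \<Longrightarrow> proj B (gact B p g) = proj B p"
    and triv: "\<exists>\<T>. (\<Union>(U, t)\<in>\<T>. U) = points (base B) \<and>
        (\<forall>(U, t)\<in>\<T>. local_trivialization B (gmfd G) U t \<and>
           (\<forall>p\<in>part_over B U. \<forall>g\<in>carrier G.
              t (gact B p g) = (fst (t p), snd (t p) \<otimes>\<^bsub>G\<^esub> g)))"
    using assms by (simp_all add: principal_bundle_def Let_def G_def)
  interpret group G using lie by (simp add: lie_group_def)
  have G: "smooth_manifold (gmfd G)" and carr: "points (gmfd G) = carrier G"
    and mult: "smooth_map (gmfd G \<times>\<^sub>M gmfd G) (gmfd G) (\<lambda>(x, y). x \<otimes>\<^bsub>G\<^esub> y)"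
    and inv: "smooth_map (gmfd G) (gmfd G) (\<lambda>x. inv\<^bsub>G\<^esub> x)"
    using lie by (simp_all add: lie_group_def)
  have P: "smooth_manifold (total B)" using fm by (simp add: fibred_manifold_def)
  let ?G = "gmfd G" and ?P = "total B"
  note GG = smooth_manifold_prod[OF G G]
  note PGG = smooth_manifold_prod[OF P GG]
  \<comment> \<open>The action factors through the smooth map sending (x, y) to x^-1 y, followed by
    the group action on the first component.\<close>
  have "smooth_map (?P \<times>\<^sub>M ?G \<times>\<^sub>M ?G) ?P
      (\<lambda>w. gact B (fst w) (inv\<^bsub>G\<^esub> (fst (snd w)) \<otimes>\<^bsub>G\<^esub> snd (snd w)))"
    by (intro smooth_map_compose2[OF PGG P G P act] smooth_map_compose2[OF PGG G G G mult]
        smooth_map_compose[OF PGG G G _ inv]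
        smooth_map_compose[OF PGG GG G _ smooth_map_fst[OF G G]]
        smooth_map_compose[OF PGG GG G _ smooth_map_snd[OF G G]]
        smooth_map_fst[OF P GG] smooth_map_snd[OF P GG])
  then have smooth: "smooth_map (?P \<times>\<^sub>M ?G \<times>\<^sub>M ?G) ?P
      (\<lambda>(p, x, y). gact B p (inv\<^bsub>G\<^esub> x \<otimes>\<^bsub>G\<^esub> y))"
    by (simp add: case_prod_unfold)
  obtain \<T> where cover: "(\<Union>(U, t)\<in>\<T>. U) = points (base B)"
    and \<T>: "\<forall>(U, t)\<in>\<T>. local_trivialization B (gmfd G) U t \<and>
      (\<forall>p\<in>part_over B U. \<forall>g\<in>carrier G.
        t (gact B p g) = (fst (t p), snd (t p) \<otimes>\<^bsub>G\<^esub> g))"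
    using triv by (elim exE conjE)
  have "t (gact B p (inv\<^bsub>G\<^esub> x \<otimes>\<^bsub>G\<^esub> y)) = (fst (t p), snd (t p) \<otimes>\<^bsub>G\<^esub> inv\<^bsub>G\<^esub> x \<otimes>\<^bsub>G\<^esub> y)"
    if "(U, t) \<in> \<T>" "p \<in> part_over B U" "x \<in> carrier G" "y \<in> carrier G" for U t p x y
  proof -
    have t: "local_trivialization B (gmfd G) U t"
      and equi: "\<And>g. g \<in> carrier G \<Longrightarrow> t (gact B p g) = (fst (t p), snd (t p) \<otimes>\<^bsub>G\<^esub> g)"
      using \<T> that(1,2) by auto
    have "snd (t p) \<in> carrier G" using local_trivialization_snd[OF t that(2)] carr by simp
    with equi that(3,4) show ?thesis by (simp add: m_assoc)
  qed
  with cover \<T> have "\<exists>\<T>. (\<Union>(U, t)\<in>\<T>. U) = points (base B) \<and>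
      (\<forall>(U, t)\<in>\<T>. local_trivialization B (gmfd G) U t \<and>
        (\<forall>p\<in>part_over B U. \<forall>x\<in>carrier G. \<forall>y\<in>carrier G.
          t (gact B p (inv\<^bsub>G\<^esub> x \<otimes>\<^bsub>G\<^esub> y)) =
            (fst (t p), snd (t p) \<otimes>\<^bsub>G\<^esub> inv\<^bsub>G\<^esub> x \<otimes>\<^bsub>G\<^esub> y)))"
    by (intro exI[of _ \<T>]) auto
  \<comment> \<open>The remaining action law amounts to (x1^-1 x2)(x3^-1 x4) = x1^-1
    \<open>[x2, x3, x4]\<close>, combined with associativity of the group action.\<close>
  then show ?thesis
    unfolding semiheap_bundle_def Let_def
    using fm lie_semiheap_group_semiheap[OF lie] smooth
    by (simp add: G_def[symmetric] carr assoc fibre m_assoc)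
qed

theorem proposition3p8:
  fixes B :: "('p, 'm, 'g, 'ep::real_inner, 'em::real_inner, 'eg::real_inner) principal_bundle_data"
    and B' :: "('q, 'n, 'h, 'eq::real_inner, 'en::real_inner, 'eh::real_inner) principal_bundle_data"
    and \<Phi> :: "'p \<Rightarrow> 'q" and \<psi> :: "'g \<Rightarrow> 'h"
  assumes "principal_bundle_hom B B' \<Phi> \<psi>"
  shows "semiheap_bundle_hom (associated_semiheap_bundle B) (associated_semiheap_bundle B') \<Phi> \<psi>"
proof -
  define G where "G = struct_group B"
  define H where "H = struct_group B'"
  have B: "principal_bundle B" "principal_bundle B'" and \<psi>: "lie_group_hom G H \<psi>"
    and \<Phi>: "smooth_bundle_map B B' \<Phi>"
    and equi: "\<And>p g. p \<in> points (total B) \<Longrightarrow> g \<in> carrier G \<Longrightarrow>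
      \<Phi> (gact B p g) = gact B' (\<Phi> p) (\<psi> g)"
    using assms by (simp_all add: principal_bundle_hom_def G_def H_def)
  interpret group_hom G H \<psi>
    using \<psi> by (simp add: group_hom_def group_hom_axioms_def lie_group_hom_def lie_group_def)
  have carr: "points (gmfd G) = carrier G"
    using \<psi> by (simp add: lie_group_hom_def lie_group_def)
  \<comment> \<open>Equivariance is \<open>equi\<close> at g = x^-1 y; the interpreted
    \<open>group_hom\<close> rewrites \<psi>(x^-1 y) as \<psi>(x)^-1 \<psi>(y).\<close>
  show ?thesis
    unfolding semiheap_bundle_hom_def
    using B \<Phi> lie_semiheap_hom_group_semiheap[OF \<psi>]
    by (simp add: semiheap_bundle_associated G_def[symmetric] H_def[symmetric] carr equi)
qed

end
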